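(* Assume that, for $\mathcal{J}_0,\mathcal{J}_1$ as in the context: (A1) $\lambda\to\infty$ as $n\to\infty$; (A2) $\sup_{\theta\in\Theta}|R_n(\theta)-R(\theta)|=o_p(1)$ as $n\to\infty$; (A3) $\Pi\left(\left\{\theta: R(\theta)-\inf_{\theta'\in\Theta}R(\theta')<a\right\}\right)>0$ for any small $a>0$; (A4) $\gamma=\inf_{j\in\mathcal{J}_1}\inf_{\theta\in\Theta_j}R(\theta)-\inf_{\theta\in\Theta}R(\theta)$ is a positive constant. Let $M^*=\{M_j:j\in\mathcal{J}_0\}$. Then the total variation distance between the distributions $\pi(\theta|\mathbf{D})$ and $\pi(\theta|M^*,\mathbf{D})$ is $o_p(1)$ as $n\to\infty$; that is, both $1-\pi(M^*|\mathbf{D})=o_p(1)$ and $\sup_{A\in\mathcal{F}}|\Pi(A|\mathbf{D})-\Pi(A|M^*,\mathbf{D})|=o_p(1)$ hold, where $\mathcal{F}$ is the set of all measurable events.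
   Context: $\mathbf{D}$ is the observed data with sample size $n$. There is a countable collection of candidate models $M_1,M_2,\ldots$ with prior probabilities $\pi(M_j)$ summing to one; model $M_j$ proposes a prior $\pi(\theta|M_j)$ for $\theta$ supported on $\Theta_j$, and $\Theta=\cup_j\Theta_j$. The overall prior is $\pi(\theta)=\sum_j\pi(\theta|M_j)\pi(M_j)$, with probability measure $\Pi$. $R_n(\theta)$ is an empirical risk function depending on $\theta$ and $\mathbf{D}$ (not on the model index), and $R(\theta)$ is a nonrandom theoretical risk function, bounded below on $\Theta$. $\lambda=\lambda_n>0$ is a scaling parameter. The joint quasi-posterior of $(\theta,M)$ is proportional to $e^{-\lambda R_n(\theta)}\pi(\theta|M_j)\pi(M_j)$, normalized to a probability distribution; $\Pi(\cdot|\mathbf{D})$ is the corresponding probability measure and $\pi(\theta|\mathbf{D})$ its marginal for $\theta$ (model averaging). The minimizer of $R$ need not be unique (partial identification). The indices of compatible models are $\mathcal{J}_0=\{j\ge1:\inf_{\theta\in\Theta_j}R(\theta)=\inf_{\theta\in\Theta}R(\theta)\}$, and $\mathcal{J}_1$ is the set of all other indices (incompatible models). The composite true model is $M^*=\{M_j:j\in\mathcal{J}_0\}$: $\pi(M^*|\mathbf{D})$ is the quasi-posterior probability that $M\in M^*$, and $\Pi(\cdot|M^*,\mathbf{D})$, $\pi(\theta|M^*,\mathbf{D})$ denote the quasi-posterior conditional on $M\in M^*$, so that $\pi(\theta|M^*,\mathbf{D})\propto e^{-\lambda R_n(\theta)}\sum_{j\in\mathcal{J}_0}\pi(\theta|M_j)\pi(M_j)$.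 $o_p$ is with respect to the law of $\mathbf{D}$. *)

theory Defs
  imports "HOL-Probability.Probability"
begin

(* Stochastic o(1) for a sequence X n of (possibly infinite) functions of the data, where the data
   of sample size n have law P n.  Suprema over uncountable sets need not be measurable, so the
   probability is the outer one; it is the ordinary probability of a measurable event
   (outer_measure_of_eq). *)
definition o_p1 :: "(nat \<Rightarrow> 'd measure) \<Rightarrow> (nat \<Rightarrow> 'd \<Rightarrow> ereal) \<Rightarrow> bool" where
  "o_p1 P X \<longleftrightarrow>
     (\<forall>e::real. 0 < e \<longrightarrow>
        (\<lambda>n. outer_measure_of (P n) {d \<in> space (P n). ereal e < \<bar>X n d\<bar>}) \<longlonglongrightarrow> 0)"

(* In what follows, T is the measurable space of parameters, w the prior distribution of the model
   index, Q j the prior of the parameter under model j, and Th j the parameter set of model j. *)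

definition prior :: "'i pmf \<Rightarrow> ('i \<Rightarrow> 'a measure) \<Rightarrow> 'a measure" where
  "prior w Q = measure_pmf w \<bind> Q"

definition joint_prior ::
    "'a measure \<Rightarrow> 'i pmf \<Rightarrow> ('i \<Rightarrow> 'a measure) \<Rightarrow> ('a \<times> 'i) measure" where
  "joint_prior T w Q =
     measure_pmf w \<bind> (\<lambda>j. distr (Q j) (T \<Otimes>\<^sub>M count_space UNIV) (\<lambda>\<theta>. (\<theta>, j)))"

(* l is the scaling parameter and r the empirical risk function for the observed data. *)
definition normalizer ::
    "'a measure \<Rightarrow> 'i pmf \<Rightarrow> ('i \<Rightarrow> 'a measure) \<Rightarrow> real \<Rightarrow> ('a \<Rightarrow> real) \<Rightarrow> ennreal" where
  "normalizer T w Q l r = (\<integral>\<^sup>+ x. ennreal (exp (- l * r (fst x))) \<partial>joint_prior T w Q)"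

definition quasi_posterior ::
    "'a measure \<Rightarrow> 'i pmf \<Rightarrow> ('i \<Rightarrow> 'a measure) \<Rightarrow> real \<Rightarrow> ('a \<Rightarrow> real) \<Rightarrow> ('a \<times> 'i) measure" where
  "quasi_posterior T w Q l r =
     density (joint_prior T w Q)
       (\<lambda>x. ennreal (exp (- l * r (fst x))) / normalizer T w Q l r)"

definition averaged_posterior ::
    "'a measure \<Rightarrow> 'i pmf \<Rightarrow> ('i \<Rightarrow> 'a measure) \<Rightarrow> real \<Rightarrow> ('a \<Rightarrow> real) \<Rightarrow> 'a measure" where
  "averaged_posterior T w Q l r = distr (quasi_posterior T w Q l r) T fst"

definition model_prob ::
    "'a measure \<Rightarrow> 'i pmf \<Rightarrow> ('i \<Rightarrow> 'a measure) \<Rightarrow> real \<Rightarrow> ('a \<Rightarrow> real) \<Rightarrow> 'i set \<Rightarrow> real" where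
  "model_prob T w Q l r J = measure (quasi_posterior T w Q l r) (space T \<times> J)"

(* uniform_measure M B is the conditional distribution M( . | B), here given that the model index
   lies in J. *)
definition conditional_posterior ::
    "'a measure \<Rightarrow> 'i pmf \<Rightarrow> ('i \<Rightarrow> 'a measure) \<Rightarrow> real \<Rightarrow> ('a \<Rightarrow> real) \<Rightarrow> 'i set \<Rightarrow> 'a measure" where
  "conditional_posterior T w Q l r J =
     distr (uniform_measure (quasi_posterior T w Q l r) (space T \<times> J)) T fst"

definition compatible ::
    "'a measure \<Rightarrow> ('i \<Rightarrow> 'a set) \<Rightarrow> ('a \<Rightarrow> real) \<Rightarrow> 'i set" where
  "compatible T Th R = {j. (INF \<theta>\<in>Th j. R \<theta>) = (INF \<theta>\<in>space T. R \<theta>)}"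

definition incompatible ::
    "'a measure \<Rightarrow> ('i \<Rightarrow> 'a set) \<Rightarrow> ('a \<Rightarrow> real) \<Rightarrow> 'i set" where
  "incompatible T Th R = - compatible T Th R"

(* Extended real, so that the gap is infinite when no model is incompatible. *)
definition risk_gap ::
    "'a measure \<Rightarrow> ('i \<Rightarrow> 'a set) \<Rightarrow> ('a \<Rightarrow> real) \<Rightarrow> ereal" where
  "risk_gap T Th R =
     (INF j\<in>incompatible T Th R. ereal (INF \<theta>\<in>Th j. R \<theta>)) - ereal (INF \<theta>\<in>space T. R \<theta>)"

end

theory Submission
  imports Defs
begin

text \<open>
  Let \<open>m\<close> be the infimum of \<open>R\<close> and \<open>0 < g < \<gamma>\<close>. If \<open>R\<^sub>n\<close> is uniformly within \<open>\<epsilon>\<close> of \<open>R\<close>, the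
  normalizer is at least \<open>exp (- \<lambda> (m + a + \<epsilon>))\<close> times the prior mass \<open>p\<close> of
  \<open>{\<theta>. R \<theta> < m + a}\<close>, whereas the incompatible models contribute at most
  \<open>exp (- \<lambda> (m + g - \<epsilon>))\<close> to it. Their posterior probability is therefore at most
  \<open>exp (- \<lambda> (g - a - 2 \<epsilon>)) / p\<close>, which vanishes as \<open>\<lambda> \<rightarrow> \<infinity>\<close> for \<open>\<epsilon> = g / 8\<close> and \<open>a < g / 4\<close>.
  Conditioning a probability measure on an event \<open>B\<close> moves it in total variation by at most
  the probability of the complement of \<open>B\<close>.
\<close>

section \<open>Stochastic smallness and conditioning on an event\<close>

text \<open>For large \<open>n\<close> the event that \<open>Y\<close> exceeds \<open>e\<close> lies
  inside the event that \<open>X\<close> exceeds \<delta>. Outer measure is monotone on arbitrary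
  sets, so suprema that may fail to be measurable cause no trouble.\<close>

lemma o_p1_transfer:
  assumes X: "o_p1 P X"
    and small: "\<And>e. 0 < e \<Longrightarrow> \<exists>\<delta>>0. \<forall>\<^sub>F n in sequentially. \<forall>d\<in>space (P n).
      \<bar>X n d\<bar> \<le> ereal \<delta> \<longrightarrow> \<bar>Y n d\<bar> \<le> ereal e"
  shows "o_p1 P Y"
  unfolding o_p1_def
proof (intro allI impI)
  fix e :: real assume "0 < e"
  then obtain \<delta> where "0 < \<delta>"
    and ev: "\<forall>\<^sub>F n in sequentially. \<forall>d\<in>space (P n). \<bar>X n d\<bar> \<le> ereal \<delta> \<longrightarrow> \<bar>Y n d\<bar> \<le> ereal e"
    using small by blast
  from X \<open>0 < \<delta>\<close> have lim:
    "(\<lambda>n. outer_measure_of (P n) {d \<in> space (P n). ereal \<delta> < \<bar>X n d\<bar>}) \<longlonglongrightarrow> 0"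
    unfolding o_p1_def by blast
  from ev have le: "\<forall>\<^sub>F n in sequentially.
      outer_measure_of (P n) {d \<in> space (P n). ereal e < \<bar>Y n d\<bar>}
      \<le> outer_measure_of (P n) {d \<in> space (P n). ereal \<delta> < \<bar>X n d\<bar>}"
    by eventually_elim (intro outer_measure_of_mono; auto simp: not_le[symmetric])
  show "(\<lambda>n. outer_measure_of (P n) {d \<in> space (P n). ereal e < \<bar>Y n d\<bar>}) \<longlonglongrightarrow> 0"
    by (rule tendsto_sandwich[OF _ le tendsto_const lim]) simp
qed

text \<open>With \<open>q\<close> the conditional probability of \<open>A\<close>, the difference
  \<open>prob A - q\<close> equals \<open>prob (A - B) - q * (1 - prob B)\<close>. Both terms lie
  between 0 and \<open>1 - prob B\<close>, so their difference is at most \<open>1 - prob B\<close>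
  in modulus.\<close>

lemma (in prob_space) abs_diff_uniform_measure_le:
  assumes A: "A \<in> events" and B: "B \<in> events" and pos: "0 < prob B"
  shows "\<bar>prob A - measure (uniform_measure M B) A\<bar> \<le> 1 - prob B"
proof -
  define q where "q = prob (B \<inter> A) / prob B"
  have q: "measure (uniform_measure M B) A = q"
    unfolding q_def using A pos
    by (intro measure_uniform_measure) (auto simp: emeasure_eq_measure)
  have split: "prob A = prob (B \<inter> A) + prob (A - B)"
    using finite_measure_Union[of "B \<inter> A" "A - B"] A B
    by (metis Diff_disjoint Int_Diff_Un Int_commute Int_Diff_disjoint sets.Diff sets.Int)
  have "prob (A - B) \<le> prob (space M - B)"
    using A B sets.sets_into_space by (intro finite_measure_mono) auto
  then have diff: "prob (A - B) \<le> 1 - prob B"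
    using B by (simp add: prob_compl)
  have "prob (B \<inter> A) \<le> prob B"
    using A B by (intro finite_measure_mono) auto
  then have "0 \<le> q" "q \<le> 1"
    using pos by (auto simp: q_def)
  then have "0 \<le> q * (1 - prob B)" "q * (1 - prob B) \<le> 1 - prob B"
    by (auto intro!: mult_left_le_one_le)
  moreover have "prob A - q = prob (A - B) - q * (1 - prob B)"
    using pos by (simp add: split q_def field_simps)
  ultimately show ?thesis
    unfolding q using diff measure_nonneg[of M "A - B"] by linarith
qed

section \<open>Mixture of the model priors\<close>

text \<open>The data do not occur here: the lemmas inside treat a fixed scaling \<open>l\<close> and
  a fixed risk function \<open>r\<close>, and randomness enters only in the final argument.\<close>

locale model_average =
  fixes T :: "'a measure" and w :: "'i pmf" and Q :: "'i \<Rightarrow> 'a measure"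
  assumes prob_space_Q: "\<And>j. prob_space (Q j)"
    and sets_Q: "\<And>j. sets (Q j) = sets T"
begin

abbreviation TI :: "('a \<times> 'i) measure" where
  "TI \<equiv> T \<Otimes>\<^sub>M count_space UNIV"

abbreviation J :: "('a \<times> 'i) measure" where
  "J \<equiv> joint_prior T w Q"

text \<open>The index space is discrete, so measurability of the kernel, which the laws of
  \<open>bind\<close> require, reduces to each \<open>Q j\<close> being a subprobability measure on
  \<open>T\<close>.\<close>

lemma measurable_Q: "Q \<in> measure_pmf w \<rightarrow>\<^sub>M subprob_algebra T"
  by (auto simp: measurable_def space_subprob_algebra sets_Q
      intro: prob_space_imp_subprob_space prob_space_Q)

lemma measurable_tag: "(\<lambda>\<theta>. (\<theta>, j)) \<in> Q j \<rightarrow>\<^sub>M TI"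
  unfolding measurable_cong_sets[OF sets_Q refl] by measurable

lemma prob_space_tag: "prob_space (distr (Q j) TI (\<lambda>\<theta>. (\<theta>, j)))"
  by (intro prob_space.prob_space_distr prob_space_Q measurable_tag)

lemma measurable_tagged_Q:
  "(\<lambda>j. distr (Q j) TI (\<lambda>\<theta>. (\<theta>, j))) \<in> measure_pmf w \<rightarrow>\<^sub>M subprob_algebra TI"
  by (auto simp: measurable_def space_subprob_algebra
      intro: prob_space_imp_subprob_space prob_space_tag)

lemma sets_joint_prior [measurable_cong]: "sets J = sets TI"
  unfolding joint_prior_def by (rule sets_bind) auto

lemma prob_space_joint_prior: "prob_space J"
  unfolding joint_prior_def
  by (rule measure_pmf.prob_space_bind[OF _ measurable_tagged_Q]) (simp add: prob_space_tag)

text \<open>This allows integrals against the joint prior to be bounded one model at a time.\<close>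

lemma nn_integral_joint_prior:
  assumes f: "f \<in> borel_measurable TI"
  shows "(\<integral>\<^sup>+x. f x \<partial>J) = (\<integral>\<^sup>+j. \<integral>\<^sup>+\<theta>. f (\<theta>, j) \<partial>Q j \<partial>measure_pmf w)"
  unfolding joint_prior_def
  by (simp add: nn_integral_bind[OF f measurable_tagged_Q] nn_integral_distr[OF measurable_tag] f)

lemma emeasure_prior:
  assumes "B \<in> sets T"
  shows "emeasure (prior w Q) B = (\<integral>\<^sup>+j. emeasure (Q j) B \<partial>measure_pmf w)"
  unfolding prior_def by (rule emeasure_bind[OF _ measurable_Q assms]) simp

lemma prob_space_prior: "prob_space (prior w Q)"
  unfolding prior_def
  by (rule measure_pmf.prob_space_bind[OF _ measurable_Q]) (simp add: prob_space_Q)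

section \<open>Bounds for exponentially weighted integrals\<close>

text \<open>Keep only the part of the integral over the sublevel set of \<open>R\<close>. There
  \<open>r\<close> is at most \<open>c + \<epsilon>\<close>, which bounds the weight below by a
  constant.\<close>

lemma normalizer_ge:
  assumes r: "r \<in> borel_measurable T" and R: "R \<in> borel_measurable T" and "0 < l"
    and close: "\<And>\<theta>. \<theta> \<in> space T \<Longrightarrow> \<bar>r \<theta> - R \<theta>\<bar> \<le> \<epsilon>"
  shows "ennreal (exp (- l * (c + \<epsilon>)) * measure (prior w Q) {\<theta> \<in> space T. R \<theta> < c})
    \<le> normalizer T w Q l r"
proof -
  let ?B = "{\<theta> \<in> space T. R \<theta> < c}" and ?K = "ennreal (exp (- l * (c + \<epsilon>)))"
  note [measurable] = r R and sp = sets_eq_imp_space_eq[OF sets_Q]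
  interpret prior: prob_space "prior w Q" by (rule prob_space_prior)
  have B: "?B \<in> sets T" by measurable
  have "ennreal (exp (- l * (c + \<epsilon>)) * measure (prior w Q) ?B)
      = ?K * (\<integral>\<^sup>+j. emeasure (Q j) ?B \<partial>measure_pmf w)"
    by (simp add: ennreal_mult prior.emeasure_eq_measure[symmetric] emeasure_prior[OF B])
  also have "\<dots> = (\<integral>\<^sup>+j. \<integral>\<^sup>+\<theta>. ?K * indicator ?B \<theta> \<partial>Q j \<partial>measure_pmf w)"
    using B by (simp add: nn_integral_cmult nn_integral_cmult_indicator sets_Q)
  also have "\<dots> \<le> (\<integral>\<^sup>+j. \<integral>\<^sup>+\<theta>. ennreal (exp (- l * r \<theta>)) \<partial>Q j \<partial>measure_pmf w)"
  proof (intro nn_integral_mono)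
    fix j \<theta>
    assume "\<theta> \<in> space (Q j)"
    then have "\<theta> \<in> space T" by (simp add: sp)
    then have "r \<theta> \<le> c + \<epsilon>" if "R \<theta> < c"
      using close[of \<theta>] that by linarith
    then show "?K * indicator ?B \<theta> \<le> ennreal (exp (- l * r \<theta>))"
      using \<open>0 < l\<close> by (auto split: split_indicator)
  qed
  also have "\<dots> = normalizer T w Q l r"
    unfolding normalizer_def by (subst nn_integral_joint_prior) auto
  finally show ?thesis .
qed

text \<open>The weight is almost everywhere at most the constant on the right, and the total prior
  mass is one. It serves twice: with all models and \<open>c = m\<close> for finiteness of the
  normalizer, and with the models outside \<open>C\<close> and \<open>c = m + g\<close> for their
  posterior mass.\<close>

lemma nn_integral_exp_risk_le:
  assumes r: "r \<in> borel_measurable T" and "0 < l"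
    and close: "\<And>\<theta>. \<theta> \<in> space T \<Longrightarrow> \<bar>r \<theta> - R \<theta>\<bar> \<le> \<epsilon>"
    and large: "\<And>j. j \<in> I \<Longrightarrow> AE \<theta> in Q j. c \<le> R \<theta>"
  shows "(\<integral>\<^sup>+x. ennreal (exp (- l * r (fst x))) * indicator (space T \<times> I) x \<partial>J)
    \<le> ennreal (exp (- l * (c - \<epsilon>)))"
proof -
  let ?K = "ennreal (exp (- l * (c - \<epsilon>)))"
  note [measurable] = r and sp = sets_eq_imp_space_eq[OF sets_Q]
  have [measurable]: "space T \<times> I \<in> sets TI" by (intro pair_measureI) auto
  have "(\<integral>\<^sup>+x. ennreal (exp (- l * r (fst x))) * indicator (space T \<times> I) x \<partial>J)
      = (\<integral>\<^sup>+j. \<integral>\<^sup>+\<theta>. ennreal (exp (- l * r \<theta>)) * indicator (space T \<times> I) (\<theta>, j) \<partial>Q j \<partial>measure_pmf w)"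
    by (subst nn_integral_joint_prior) auto
  also have "\<dots> \<le> (\<integral>\<^sup>+j. \<integral>\<^sup>+\<theta>. ?K \<partial>Q j \<partial>measure_pmf w)"
  proof (rule nn_integral_mono)
    fix j
    show "(\<integral>\<^sup>+\<theta>. ennreal (exp (- l * r \<theta>)) * indicator (space T \<times> I) (\<theta>, j) \<partial>Q j) \<le> (\<integral>\<^sup>+\<theta>. ?K \<partial>Q j)"
    proof (cases "j \<in> I")
      case True
      show ?thesis
      proof (rule nn_integral_mono_AE)
        show "AE \<theta> in Q j. ennreal (exp (- l * r \<theta>)) * indicator (space T \<times> I) (\<theta>, j) \<le> ?K"
          using large[OF True] AE_space
        proof eventually_elim
          fix \<theta> assume "c \<le> R \<theta>" "\<theta> \<in> space (Q j)"
          then have "c - \<epsilon> \<le> r \<theta>" using close[of \<theta>] by (simp add: sp)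
          then show "ennreal (exp (- l * r \<theta>)) * indicator (space T \<times> I) (\<theta>, j) \<le> ?K"
            using \<open>0 < l\<close> by (auto split: split_indicator)
        qed
      qed
    qed (simp add: indicator_def)
  qed
  also have "\<dots> = ?K"
    by (simp add: prob_space.emeasure_space_1[OF prob_space_Q])
  finally show ?thesis .
qed

section \<open>The quasi-posterior for fixed data\<close>

text \<open>The total mass is the normalizer divided by itself, which is 1 in \<open>ennreal\<close>
  exactly when it is neither zero nor infinite.\<close>

lemma prob_space_quasi_posterior:
  assumes r: "r \<in> borel_measurable T"
    and Z: "normalizer T w Q l r \<noteq> 0" "normalizer T w Q l r \<noteq> \<infinity>"
  shows "prob_space (quasi_posterior T w Q l r)"
proof
  note [measurable] = r
  have "emeasure (quasi_posterior T w Q l r) (space J)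
      = (\<integral>\<^sup>+x. ennreal (exp (- l * r (fst x))) / normalizer T w Q l r \<partial>J)"
    unfolding quasi_posterior_def
    by (subst emeasure_density) (auto intro!: nn_integral_cong)
  also have "\<dots> = normalizer T w Q l r / normalizer T w Q l r"
    unfolding normalizer_def by (rule nn_integral_divide) simp
  finally show "emeasure (quasi_posterior T w Q l r) (space (quasi_posterior T w Q l r)) = 1"
    using Z by (simp add: quasi_posterior_def ennreal_divide_self less_top)
qed

text \<open>The upper bound for the mass outside \<open>C\<close> is divided by the lower bound for
  the normalizer. In the exponents \<open>m\<close> cancels and \<epsilon> is lost once in each
  bound, which leaves \<open>g - a - 2 * \<epsilon>\<close>.\<close>

lemma quasi_posterior_incompatible_le:
  assumes r: "r \<in> borel_measurable T" and R: "R \<in> borel_measurable T" and "0 < l"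
    and close: "\<And>\<theta>. \<theta> \<in> space T \<Longrightarrow> \<bar>r \<theta> - R \<theta>\<bar> \<le> \<epsilon>"
    and lower: "\<And>\<theta>. \<theta> \<in> space T \<Longrightarrow> m \<le> R \<theta>"
    and pos: "0 < measure (prior w Q) {\<theta> \<in> space T. R \<theta> < m + a}"
    and gap: "\<And>j. j \<notin> C \<Longrightarrow> AE \<theta> in Q j. m + g \<le> R \<theta>"
  shows "prob_space (quasi_posterior T w Q l r)"
    and "1 - model_prob T w Q l r C
      \<le> exp (- l * (g - a - 2 * \<epsilon>)) / measure (prior w Q) {\<theta> \<in> space T. R \<theta> < m + a}"
proof -
  define p where "p = measure (prior w Q) {\<theta> \<in> space T. R \<theta> < m + a}"
  note [measurable] = r R
  let ?Z = "normalizer T w Q l r" and ?M = "quasi_posterior T w Q l r"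
  have Z_ge: "ennreal (exp (- l * (m + a + \<epsilon>)) * p) \<le> ?Z"
    unfolding p_def by (rule normalizer_ge[OF r R \<open>0 < l\<close> close])
  \<comment> \<open>A trivial indicator brings the normalizer into the form of the upper bound with
    all models included.\<close>
  have "?Z = (\<integral>\<^sup>+x. ennreal (exp (- l * r (fst x))) * indicator (space T \<times> UNIV) x \<partial>J)"
    unfolding normalizer_def
    by (rule nn_integral_cong)
      (auto simp: sets_eq_imp_space_eq[OF sets_joint_prior] space_pair_measure)
  also have "\<dots> \<le> ennreal (exp (- l * (m - \<epsilon>)))"
  proof (rule nn_integral_exp_risk_le[OF r \<open>0 < l\<close> close])
    show "AE \<theta> in Q j. m \<le> R \<theta>" for j
      by (rule AE_I2) (simp add: lower sets_eq_imp_space_eq[OF sets_Q])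
  qed
  finally have Z_fin: "?Z \<noteq> \<infinity>" by (auto simp: top_unique)
  have p: "0 < p" using pos by (simp add: p_def)
  then have "0 < ennreal (exp (- l * (m + a + \<epsilon>)) * p)" by simp
  with Z_ge have Z_pos: "?Z \<noteq> 0" by auto
  show prob: "prob_space ?M" by (rule prob_space_quasi_posterior[OF r Z_pos Z_fin])
  interpret M: prob_space ?M by (rule prob)
  have sets_M: "sets ?M = sets TI" by (simp add: quasi_posterior_def sets_joint_prior)
  have space_M: "space ?M = space T \<times> UNIV"
    by (simp add: sets_eq_imp_space_eq[OF sets_M] space_pair_measure)
  have CI [measurable]: "space T \<times> I \<in> sets TI" for I :: "'i set"
    by (intro pair_measureI) auto
  \<comment> \<open>A positive real representative lets the quotient be estimated by real
    division.\<close>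
  obtain z where z: "?Z = ennreal z" "0 < z"
    using Z_fin Z_pos by (cases ?Z) (auto simp: less_le)
  have z_ge: "exp (- l * (m + a + \<epsilon>)) * p \<le> z"
    using Z_ge z p by simp
  have "emeasure ?M (space T \<times> (- C))
      = (\<integral>\<^sup>+x. ennreal (exp (- l * r (fst x))) / ?Z * indicator (space T \<times> (- C)) x \<partial>J)"
    unfolding quasi_posterior_def by (rule emeasure_density) measurable
  also have "\<dots> = (\<integral>\<^sup>+x. ennreal (exp (- l * r (fst x))) * indicator (space T \<times> (- C)) x / ?Z \<partial>J)"
    by (intro nn_integral_cong) (auto split: split_indicator)
  also have "\<dots> = (\<integral>\<^sup>+x. ennreal (exp (- l * r (fst x))) * indicator (space T \<times> (- C)) x \<partial>J) / ?Z"
    by (rule nn_integral_divide) measurable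
  also have "\<dots> \<le> ennreal (exp (- l * (m + g - \<epsilon>))) / ?Z"
    using gap by (intro divide_right_mono_ennreal nn_integral_exp_risk_le[OF r \<open>0 < l\<close> close]) auto
  also have "\<dots> = ennreal (exp (- l * (m + g - \<epsilon>)) / z)"
    using z by (simp add: divide_ennreal)
  also have "\<dots> \<le> ennreal (exp (- l * (m + g - \<epsilon>)) / (exp (- l * (m + a + \<epsilon>)) * p))"
    using z_ge z p by (intro ennreal_leI divide_left_mono) auto
  also have "exp (- l * (m + g - \<epsilon>)) / (exp (- l * (m + a + \<epsilon>)) * p) = exp (- l * (g - a - 2 * \<epsilon>)) / p"
    by (simp add: divide_divide_eq_left[symmetric] exp_diff[symmetric] del: divide_divide_eq_left)
      (simp add: algebra_simps)
  finally have "measure ?M (space T \<times> (- C)) \<le> exp (- l * (g - a - 2 * \<epsilon>)) / p"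
    using p by (simp add: M.emeasure_eq_measure)
  moreover have "measure ?M (space T \<times> (- C)) = 1 - measure ?M (space T \<times> C)"
  proof -
    have "space ?M - space T \<times> C = space T \<times> (- C)" by (auto simp: space_M)
    then show ?thesis using M.prob_compl[of "space T \<times> C"] CI[of C] by (simp add: sets_M)
  qed
  ultimately show "1 - model_prob T w Q l r C
      \<le> exp (- l * (g - a - 2 * \<epsilon>)) / measure (prior w Q) {\<theta> \<in> space T. R \<theta> < m + a}"
    by (simp add: model_prob_def p_def)
qed

text \<open>Both marginals are images under \<open>fst\<close>, so the conditioning bound applies to
  the preimage of \<open>A\<close> in the joint space. Positivity of the model probability keeps the
  conditioning well defined.\<close>

lemma averaged_posterior_conditional_diff_le:
  assumes prob: "prob_space (quasi_posterior T w Q l r)"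
    and pos: "0 < model_prob T w Q l r C" and A: "A \<in> sets T"
  shows "\<bar>measure (averaged_posterior T w Q l r) A - measure (conditional_posterior T w Q l r C) A\<bar>
    \<le> 1 - model_prob T w Q l r C"
proof -
  let ?M = "quasi_posterior T w Q l r"
  interpret M: prob_space ?M by (rule prob)
  have sets_M: "sets ?M = sets TI" by (simp add: quasi_posterior_def sets_joint_prior)
  have fst: "fst \<in> ?M \<rightarrow>\<^sub>M T" "fst \<in> uniform_measure ?M (space T \<times> C) \<rightarrow>\<^sub>M T"
    by (simp_all add: measurable_cong_sets[OF sets_M refl]
        measurable_cong_sets[OF sets_uniform_measure refl])
  have "space T \<times> C \<in> sets ?M"
    unfolding sets_M by (intro pair_measureI) auto
  with pos show ?thesis
    unfolding averaged_posterior_def conditional_posterior_def measure_distr[OF fst(1) A]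
      measure_distr[OF fst(2) A] model_prob_def space_uniform_measure
    by (intro M.abs_diff_uniform_measure_le measurable_sets[OF fst(1) A])
qed

end

section \<open>From fixed data to convergence in probability\<close>

theorem theorem4:
  fixes P :: "nat \<Rightarrow> 'd measure"
    and T :: "'a measure"
    and w :: "'i::countable pmf"
    and Q :: "'i \<Rightarrow> 'a measure"
    and Th :: "'i \<Rightarrow> 'a set"
    and Rn :: "nat \<Rightarrow> 'd \<Rightarrow> 'a \<Rightarrow> real"
    and R :: "'a \<Rightarrow> real"
    and l :: "nat \<Rightarrow> real"
  assumes data: "\<And>n. prob_space (P n)"
    and model_priors: "\<And>j. prob_space (Q j)" "\<And>j. sets (Q j) = sets T"
    and supports: "\<And>j. Th j \<in> sets T" "\<And>j. AE \<theta> in Q j. \<theta> \<in> Th j"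
    and parameter_space: "space T = (\<Union>j. Th j)"
    and theoretical_risk: "R \<in> borel_measurable T" "bdd_below (R ` space T)"
    and empirical_risk: "\<And>n d. d \<in> space (P n) \<Longrightarrow> Rn n d \<in> borel_measurable T"
    and scaling_pos: "\<And>n. 0 < l n"
    and normalizable: "\<And>n. AE d in P n. normalizer T w Q (l n) (Rn n d) < \<infinity>"
    and A1: "filterlim l at_top sequentially"
    and A2: "o_p1 P (\<lambda>n d. SUP \<theta>\<in>space T. ereal \<bar>Rn n d \<theta> - R \<theta>\<bar>)"
    and A3: "\<forall>\<^sub>F a in at_right 0.
               0 < measure (prior w Q) {\<theta> \<in> space T. R \<theta> - (INF \<theta>'\<in>space T. R \<theta>') < a}"
    and A4: "0 < risk_gap T Th R"
  shows "o_p1 P (\<lambda>n d. ereal (1 - model_prob T w Q (l n) (Rn n d) (compatible T Th R))) \<and>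
         o_p1 P (\<lambda>n d. SUP A\<in>sets T. ereal
           \<bar>measure (averaged_posterior T w Q (l n) (Rn n d)) A
            - measure (conditional_posterior T w Q (l n) (Rn n d) (compatible T Th R)) A\<bar>)"
proof -
  interpret model_average T w Q
    using model_priors by (rule model_average.intro)
  let ?C = "compatible T Th R"
  define m where "m = (INF \<theta>\<in>space T. R \<theta>)"
  have lower: "m \<le> R \<theta>" if "\<theta> \<in> space T" for \<theta>
    unfolding m_def by (rule cINF_lower[OF theoretical_risk(2) that])
  \<comment> \<open>The gap may be infinite, so a positive real below it takes its place.\<close>
  obtain g :: real where g: "0 < g" "ereal g < risk_gap T Th R"
    using ereal_dense2[OF A4] by auto
  have gap: "AE \<theta> in Q j. m + g \<le> R \<theta>" if "j \<notin> ?C" for j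
  proof -
    have "ereal g \<le> (INF j\<in>incompatible T Th R. ereal (INF \<theta>\<in>Th j. R \<theta>)) - ereal m"
      using g(2) by (simp add: risk_gap_def m_def)
    then have "ereal g + ereal m \<le> (INF j\<in>incompatible T Th R. ereal (INF \<theta>\<in>Th j. R \<theta>))"
      by (subst (asm) ereal_le_minus) auto
    also have "\<dots> \<le> ereal (INF \<theta>\<in>Th j. R \<theta>)"
      using that by (intro INF_lower) (simp add: incompatible_def)
    finally have Inf: "m + g \<le> (INF \<theta>\<in>Th j. R \<theta>)" by simp
    \<comment> \<open>A real-valued infimum is a lower bound only for a set bounded below; the bound
      is inherited from the whole parameter space.\<close>
    have "bdd_below (R ` Th j)"
      using theoretical_risk(2) by (rule bdd_below_mono) (auto simp: parameter_space)
    then have "m + g \<le> R \<theta>" if "\<theta> \<in> Th j" for \<theta>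
      using Inf cINF_lower[of R "Th j" \<theta>] that by linarith
    then show ?thesis
      using supports(2)[of j] by auto
  qed
  \<comment> \<open>A single \<open>a\<close> is enough, and it exists since
    \<open>at_right 0\<close> is a nontrivial filter. With \<epsilon> equal to \<open>g / 8\<close>,
    the bound \<open>a < g / 4\<close> leaves an exponent rate \<open>g - a - 2 * \<epsilon>\<close>
    above \<open>g / 2\<close>.\<close>
  have "\<forall>\<^sub>F a in at_right 0. 0 < a \<and> a < g / 4 \<and>
      0 < measure (prior w Q) {\<theta> \<in> space T. R \<theta> - (INF \<theta>'\<in>space T. R \<theta>') < a}"
    using A3 eventually_at_right_less[of "0::real"]
      eventually_at_rightI[of 0 "g / 4" "\<lambda>a. a < g / 4"] g(1)
    by (auto intro: eventually_conj)
  then obtain a where a: "0 < a" "a < g / 4"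
    and "0 < measure (prior w Q) {\<theta> \<in> space T. R \<theta> - (INF \<theta>'\<in>space T. R \<theta>') < a}"
    using eventually_happens'[OF trivial_limit_at_right_real] by blast
  moreover have "{\<theta> \<in> space T. R \<theta> - (INF \<theta>'\<in>space T. R \<theta>') < a} = {\<theta> \<in> space T. R \<theta> < m + a}"
    by (auto simp: m_def)
  moreover define p where "p = measure (prior w Q) {\<theta> \<in> space T. R \<theta> < m + a}"
  ultimately have p: "0 < p" by simp
  \<comment> \<open>A nonrandom bound: \<open>p\<close> is a fixed prior mass, so A1 alone drives
    \<open>b\<close> to zero.\<close>
  define b where "b n = exp (- l n * (g / 2)) / p" for n
  have "filterlim (\<lambda>n. l n * (g / 2)) at_top sequentially"
    using g(1) by (intro filterlim_at_top_mult_tendsto_pos[OF tendsto_const _ A1]) simp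
  then have "filterlim (\<lambda>n. - l n * (g / 2)) at_bot sequentially"
    by (simp add: filterlim_uminus_at_top)
  then have "(\<lambda>n. exp (- l n * (g / 2))) \<longlonglongrightarrow> 0"
    by (rule filterlim_compose[OF exp_at_bot])
  then have b_lim: "b \<longlonglongrightarrow> 0"
    unfolding b_def using tendsto_divide_zero by blast
  let ?S = "\<lambda>n d. SUP \<theta>\<in>space T. ereal \<bar>Rn n d \<theta> - R \<theta>\<bar>"
  have main: "prob_space (quasi_posterior T w Q (l n) (Rn n d))"
      "1 - model_prob T w Q (l n) (Rn n d) ?C \<le> b n"
    if d: "d \<in> space (P n)" and S: "\<bar>?S n d\<bar> \<le> ereal (g / 8)" for n d
  proof -
    have "\<bar>Rn n d \<theta> - R \<theta>\<bar> \<le> g / 8" if "\<theta> \<in> space T" for \<theta>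
    proof -
      have "ereal \<bar>Rn n d \<theta> - R \<theta>\<bar> \<le> ?S n d" by (rule SUP_upper[OF that])
      also have "\<dots> \<le> \<bar>?S n d\<bar>" by (cases "?S n d") auto
      finally show ?thesis using S by (meson ereal_less_eq(3) order_trans)
    qed
    note est = quasi_posterior_incompatible_le[OF empirical_risk[OF d] theoretical_risk(1)
        scaling_pos[of n] this lower p[unfolded p_def] gap]
    show "prob_space (quasi_posterior T w Q (l n) (Rn n d))" by (rule est(1))
    have "1 - model_prob T w Q (l n) (Rn n d) ?C \<le> exp (- l n * (g - a - 2 * (g / 8))) / p"
      using est(2) by (simp add: p_def)
    also have "\<dots> \<le> b n"
      unfolding b_def using p a(2) scaling_pos[of n] by (intro divide_right_mono) auto
    finally show "1 - model_prob T w Q (l n) (Rn n d) ?C \<le> b n" .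
  qed
  have g8: "0 < g / 8" using g(1) by simp
  have "o_p1 P (\<lambda>n d. ereal (1 - model_prob T w Q (l n) (Rn n d) ?C))"
  \<comment> \<open>The same \<delta>, namely \<open>g / 8\<close>, works for every
    \<open>e\<close>: smallness comes from \<open>b n\<close>, while A2 only supplies the event on
    which the bound holds.\<close>
  proof (rule o_p1_transfer[OF A2])
    fix e :: real assume "0 < e"
    have "\<forall>\<^sub>F n in sequentially. b n < e"
      using order_tendstoD(2)[OF b_lim \<open>0 < e\<close>] .
    then have "\<forall>\<^sub>F n in sequentially. \<forall>d\<in>space (P n). \<bar>?S n d\<bar> \<le> ereal (g / 8) \<longrightarrow>
        \<bar>ereal (1 - model_prob T w Q (l n) (Rn n d) ?C)\<bar> \<le> ereal e"
    proof (eventually_elim, intro ballI impI)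
      fix n d assume *: "b n < e" "d \<in> space (P n)" "\<bar>?S n d\<bar> \<le> ereal (g / 8)"
      have "model_prob T w Q (l n) (Rn n d) ?C \<le> 1"
        unfolding model_prob_def by (rule prob_space.prob_le_1[OF main(1)[OF *(2,3)]])
      then show "\<bar>ereal (1 - model_prob T w Q (l n) (Rn n d) ?C)\<bar> \<le> ereal e"
        using main(2)[OF *(2,3)] *(1) by simp
    qed
    with g8 show "\<exists>\<delta>>0. \<forall>\<^sub>F n in sequentially. \<forall>d\<in>space (P n). \<bar>?S n d\<bar> \<le> ereal \<delta> \<longrightarrow>
        \<bar>ereal (1 - model_prob T w Q (l n) (Rn n d) ?C)\<bar> \<le> ereal e"
      by blast
  qed
  moreover have "o_p1 P (\<lambda>n d. SUP A\<in>sets T. ereal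
      \<bar>measure (averaged_posterior T w Q (l n) (Rn n d)) A
       - measure (conditional_posterior T w Q (l n) (Rn n d) ?C) A\<bar>)"
    (is "o_p1 P (\<lambda>n d. SUP A\<in>sets T. ereal (?D n d A))")
  proof (rule o_p1_transfer[OF A2])
    fix e :: real assume "0 < e"
    \<comment> \<open>The bound by 1 makes the probability of the compatible models positive, as
      conditioning on them requires; the bound by \<open>e\<close> controls the distance.\<close>
    then have "\<forall>\<^sub>F n in sequentially. b n < min e 1"
      by (intro order_tendstoD(2)[OF b_lim]) auto
    then have "\<forall>\<^sub>F n in sequentially. \<forall>d\<in>space (P n). \<bar>?S n d\<bar> \<le> ereal (g / 8) \<longrightarrow>
        \<bar>SUP A\<in>sets T. ereal (?D n d A)\<bar> \<le> ereal e"
    proof (eventually_elim, intro ballI impI)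
      fix n d assume *: "b n < min e 1" "d \<in> space (P n)" "\<bar>?S n d\<bar> \<le> ereal (g / 8)"
      have pos: "0 < model_prob T w Q (l n) (Rn n d) ?C"
        using main(2)[OF *(2,3)] *(1) by simp
      have "?D n d A \<le> e" if "A \<in> sets T" for A
        using averaged_posterior_conditional_diff_le[OF main(1)[OF *(2,3)] pos that]
          main(2)[OF *(2,3)] *(1) by linarith
      then have "(SUP A\<in>sets T. ereal (?D n d A)) \<le> ereal e"
        by (intro SUP_least) simp
      moreover have "0 \<le> (SUP A\<in>sets T. ereal (?D n d A))"
        by (rule SUP_upper2[of "{}"]) auto
      ultimately show "\<bar>SUP A\<in>sets T. ereal (?D n d A)\<bar> \<le> ereal e"
        by simp
    qed
    with g8 show "\<exists>\<delta>>0. \<forall>\<^sub>F n in sequentially. \<forall>d\<in>space (P n). \<bar>?S n d\<bar> \<le> ereal \<delta> \<longrightarrow>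
        \<bar>SUP A\<in>sets T. ereal (?D n d A)\<bar> \<le> ereal e"
      by blast
  qed
  ultimately show ?thesis by blast
qed

end
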